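(* Let $T>0$, let $W$ be a standard Brownian motion on $[0,T]$ and let $X_t=W_t-\frac{t}{T}W_T$, $t\in[0,T]$, be the Brownian bridge over $[0,T]$. Then $X$ satisfies a functional co-monotony principle on $\mathcal{C}([0,T],\mathbb{R})$.
   Context: $\mathcal{C}([0,T],\mathbb{R})$ is equipped with the sup-norm, its Borel $\sigma$-field, and the pointwise order: $\alpha\le\beta$ if $\alpha(t)\le\beta(t)$ for all $t\in[0,T]$. Two measurable functionals $F,G$ on this space are co-monotone if they are both non-decreasing or both non-increasing for this order. $F$ is $\mathbb{P}_X$-a.s. continuous if it is sup-norm continuous at every point of a set of probability $1$ under the distribution $\mathbb{P}_X$ of $X$. A continuous process $X$ satisfies a functional co-monotony principle on $\mathcal{C}([0,T],\mathbb{R})$ if, for every pair of bounded, co-monotone, $\mathbb{P}_X$-a.s. continuous, measurable functionals $F,G:\mathcal{C}([0,T],\mathbb{R})\to\mathbb{R}$, $\mathbb{E}\,F(X)G(X)\ge\mathbb{E}\,F(X)\,\mathbb{E}\,G(X)$. *)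

theory Defs
  imports "HOL-Probability.Probability"
begin

section \<open>The path space \<open>C([0,T], R)\<close>\<close>

text \<open>
  Paths are functions \<open>real \<Rightarrow> real\<close> that are continuous on \<open>{0..T}\<close> and extensional, i.e. equal to
  \<open>undefined\<close> outside \<open>{0..T}\<close>, so that each element of \<open>C([0,T], R)\<close> has exactly one
  representative (see \<open>mspace_path_metric\<close> and \<open>mdist_path_metric\<close> below).
\<close>

definition path_metric :: "real \<Rightarrow> (real \<Rightarrow> real) metric" where
  "path_metric T = cfunspace (top_of_set {0..T}) euclidean_metric"

abbreviation path_space :: "real \<Rightarrow> (real \<Rightarrow> real) set" where
  "path_space T \<equiv> mspace (path_metric T)"

abbreviation path_topology :: "real \<Rightarrow> (real \<Rightarrow> real) topology" where
  "path_topology T \<equiv> mtopology_of (path_metric T)"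

definition path_borel :: "real \<Rightarrow> (real \<Rightarrow> real) measure" where
  "path_borel T = sigma (path_space T) {U. openin (path_topology T) U}"

lemma mspace_path_metric:
  "path_space T = {\<alpha> \<in> extensional {0..T}. continuous_on {0..T} \<alpha>}"
proof -
  have "Metric_space.mbounded UNIV dist (\<alpha> ` {0..T})"
    if "continuous_on {0..T} \<alpha>" for \<alpha> :: "real \<Rightarrow> real"
    using compact_imp_bounded[OF compact_continuous_image[OF that compact_Icc]]
    by (simp add: Met_TC.mbounded_def bounded_subset_cball mcball_eq_cball)
  then show ?thesis
    by (auto simp: path_metric_def Metric_space.fspace_def Met_TC.fspace_def)
qed

lemma mdist_path_metric:
  assumes "0 \<le> T" "\<alpha> \<in> path_space T" "\<beta> \<in> path_space T"
  shows "mdist (path_metric T) \<alpha> \<beta> = (SUP t\<in>{0..T}. \<bar>\<alpha> t - \<beta> t\<bar>)"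
  using assms
  by (simp add: path_metric_def mdist_cfunspace_eq_mdist_funspace Met_TC.fdist_def
      Met_TC.fspace_def mspace_path_metric dist_real_def)

lemma space_path_borel: "space (path_borel T) = path_space T"
  unfolding path_borel_def
  by (rule space_measure_of) (use openin_subset in fastforce)

lemma sets_path_borel:
  "sets (path_borel T) = sigma_sets (path_space T) {U. openin (path_topology T) U}"
  unfolding path_borel_def
  by (rule sets_measure_of) (use openin_subset in fastforce)


section \<open>Processes with continuous paths\<close>

text \<open>
  A process on \<open>[0,T]\<close> is a family \<open>X t\<close> of real random variables; only the indices \<open>t \<in> {0..T}\<close>
  matter. The map \<open>path_of T X\<close> is the associated random element of \<open>C([0,T], R)\<close>, and
  \<open>distr M (path_borel T) (path_of T X)\<close> is its distribution.
\<close>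

definition continuous_process ::
    "'a measure \<Rightarrow> real \<Rightarrow> (real \<Rightarrow> 'a \<Rightarrow> real) \<Rightarrow> bool" where
  "continuous_process M T X \<longleftrightarrow>
     prob_space M \<and>
     (\<forall>t\<in>{0..T}. X t \<in> borel_measurable M) \<and>
     (\<forall>\<omega>\<in>space M. continuous_on {0..T} (\<lambda>t. X t \<omega>))"

definition path_of :: "real \<Rightarrow> (real \<Rightarrow> 'a \<Rightarrow> real) \<Rightarrow> 'a \<Rightarrow> (real \<Rightarrow> real)" where
  "path_of T X \<omega> = (\<lambda>t\<in>{0..T}. X t \<omega>)"

text \<open>
  \<open>normal_density \<mu> \<sigma>\<close> is parametrised by the standard deviation, hence the square root.
\<close>

definition standard_brownian_motion ::
    "'a measure \<Rightarrow> real \<Rightarrow> (real \<Rightarrow> 'a \<Rightarrow> real) \<Rightarrow> bool" where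
  "standard_brownian_motion M T W \<longleftrightarrow>
     continuous_process M T W \<and>
     (AE \<omega> in M. W 0 \<omega> = 0) \<and>
     (\<forall>(n::nat) t. (\<forall>i\<le>n. t i \<in> {0..T}) \<and> (\<forall>i<n. t i < t (Suc i)) \<longrightarrow>
        prob_space.indep_vars M (\<lambda>_. borel) (\<lambda>i \<omega>. W (t (Suc i)) \<omega> - W (t i) \<omega>) {..<n}) \<and>
     (\<forall>s t. 0 \<le> s \<and> s < t \<and> t \<le> T \<longrightarrow>
        distributed M lborel (\<lambda>\<omega>. W t \<omega> - W s \<omega>) (normal_density 0 (sqrt (t - s))))"

definition brownian_bridge ::
    "real \<Rightarrow> (real \<Rightarrow> 'a \<Rightarrow> real) \<Rightarrow> (real \<Rightarrow> 'a \<Rightarrow> real)" where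
  "brownian_bridge T W t \<omega> = W t \<omega> - t / T * W T \<omega>"


section \<open>The functional co-monotony principle\<close>

text \<open>
  Functionals on \<open>C([0,T], R)\<close> are HOL functions on \<open>real \<Rightarrow> real\<close> of which only the restriction to
  \<open>path_space T\<close> is relevant.
\<close>

definition path_le :: "real \<Rightarrow> (real \<Rightarrow> real) \<Rightarrow> (real \<Rightarrow> real) \<Rightarrow> bool" where
  "path_le T \<alpha> \<beta> \<longleftrightarrow> (\<forall>t\<in>{0..T}. \<alpha> t \<le> \<beta> t)"

definition co_monotone ::
    "real \<Rightarrow> ((real \<Rightarrow> real) \<Rightarrow> real) \<Rightarrow> ((real \<Rightarrow> real) \<Rightarrow> real) \<Rightarrow> bool" where
  "co_monotone T F G \<longleftrightarrow>
     (monotone_on (path_space T) (path_le T) (\<le>) F \<and>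
      monotone_on (path_space T) (path_le T) (\<le>) G) \<or>
     (monotone_on (path_space T) (path_le T) (\<ge>) F \<and>
      monotone_on (path_space T) (path_le T) (\<ge>) G)"

definition AE_path_continuous ::
    "'a measure \<Rightarrow> real \<Rightarrow> (real \<Rightarrow> 'a \<Rightarrow> real) \<Rightarrow> ((real \<Rightarrow> real) \<Rightarrow> real) \<Rightarrow> bool" where
  "AE_path_continuous M T X F \<longleftrightarrow>
     (AE \<alpha> in distr M (path_borel T) (path_of T X).
        topcontinuous_at (path_topology T) euclidean F \<alpha>)"

definition functional_co_monotony_principle ::
    "'a measure \<Rightarrow> real \<Rightarrow> (real \<Rightarrow> 'a \<Rightarrow> real) \<Rightarrow> bool" where
  "functional_co_monotony_principle M T X \<longleftrightarrow>
     continuous_process M T X \<and>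
     (\<forall>F G.
        F \<in> borel_measurable (path_borel T) \<and> G \<in> borel_measurable (path_borel T) \<and>
        bounded (F ` path_space T) \<and> bounded (G ` path_space T) \<and>
        co_monotone T F G \<and>
        AE_path_continuous M T X F \<and> AE_path_continuous M T X G \<longrightarrow>
        (\<integral>\<omega>. F (path_of T X \<omega>) * G (path_of T X \<omega>) \<partial>M) \<ge>
        (\<integral>\<omega>. F (path_of T X \<omega>) \<partial>M) * (\<integral>\<omega>. G (path_of T X \<omega>) \<partial>M))"

end

(*
  Write S_k for the Brownian motion at time kT/N. The regression residuals
  U_k = S_k - k/(k+1) S_{k+1}, 1 <= k < N, are independent, and telescoping S_k/k gives
  X_{kT/N} = k * sum_{j=k}^{N-1} U_j / j for the bridge X. So the bridge on a grid is a
  non-decreasing function of independent variables, and Harris' inequality yields the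
  co-monotony of functionals of its Bernstein polynomials. Those are non-decreasing in the
  grid values and converge uniformly to the path, so dominated convergence concludes.
*)
theory Submission
  imports Defs
begin

text \<open>The increments of \<open>W\<close> are independent but do not suit Harris' inequality:
  the bridge at a grid time increases with the increments before that time and decreases with those
  after it, while the bridge's own increments are negatively correlated. Looking backwards in time
  removes the signs. The averages S_k / k form a reverse martingale with differences U_k / k = S_k /
  k - S_{k+1} / (k+1), and k/(k+1) is the covariance of S_k and S_{k+1} divided by the variance of
  S_{k+1}. Independence of the residuals is derived from explicit densities of two variables at a
  time instead of multivariate normal laws. Bernstein polynomials serve twice: besides approximating
  monotonically, they exhibit the random path as a limit of measurable maps, which makes it Borel
  measurable. Association of the approximations uses monotonicity only; almost sure continuity
  enters when they converge to the path.\<close>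

section \<open>Harris' inequality\<close>

text \<open>Two independent copies: in a linear order any two points are comparable, so (f x - f y)
  (g x - g y) is never negative. Integrating it over y and then over x gives twice the covariance of
  f and g.\<close>

lemma chebyshev_association:
  fixes M :: "'a :: linorder measure" and f g :: "'a \<Rightarrow> real"
  assumes M: "prob_space M"
    and [measurable]: "f \<in> borel_measurable M" "g \<in> borel_measurable M"
    and bnd: "\<And>x. x \<in> space M \<Longrightarrow> \<bar>f x\<bar> \<le> B" "\<And>x. x \<in> space M \<Longrightarrow> \<bar>g x\<bar> \<le> C"
    and mono: "monotone_on (space M) (\<le>) (\<le>) f" "monotone_on (space M) (\<le>) (\<le>) g"
  shows "(\<integral>x. f x \<partial>M) * (\<integral>x. g x \<partial>M) \<le> (\<integral>x. f x * g x \<partial>M)"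
proof -
  interpret prob_space M
    by (rule M)
  have [simp]: "integrable M f" "integrable M g"
    by (rule integrable_const_bound, use bnd in \<open>auto intro!: AE_I2\<close>)+
  have [simp]: "integrable M (\<lambda>x. f x * g x)"
    by (rule integrable_const_bound[where B = "B * C"])
      (use bnd in \<open>auto simp: abs_mult intro!: mult_mono' AE_I2\<close>)
  have nonneg: "0 \<le> (f x - f y) * (g x - g y)" if "x \<in> space M" "y \<in> space M" for x y
    using that mono
    by (cases x y rule: linorder_cases)
      (auto simp: monotone_on_def zero_le_mult_iff dest: less_imp_le)
  have "0 \<le> expectation (\<lambda>y. (f x - f y) * (g x - g y))" if "x \<in> space M" for x
    by (rule integral_nonneg_AE) (use nonneg that in auto)
  also have "expectation (\<lambda>y. (f x - f y) * (g x - g y)) =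
      f x * g x - f x * expectation g - g x * expectation f + expectation (\<lambda>y. f y * g y)" for x
    by (simp add: algebra_simps prob_space)
  finally have "0 \<le> expectation (\<lambda>x.
      f x * g x - f x * expectation g - g x * expectation f + expectation (\<lambda>y. f y * g y))"
    by (intro integral_nonneg_AE) auto
  then show ?thesis
    by (simp add: prob_space)
qed

text \<open>Integrating out one coordinate \<open>i\<close> preserves monotonicity in the others.
  The one-dimensional inequality applies with the remaining coordinates frozen, and the induction
  hypothesis applies to the partial integrals \<open>F\<close> and \<open>G\<close>: E[f g] \<ge>
  E[F G] \<ge> E[F] E[G] = E[f] E[g].\<close>

lemma harris_inequality:
  fixes N :: "'i \<Rightarrow> 'b :: linorder measure" and f g :: "('i \<Rightarrow> 'b) \<Rightarrow> real"
  assumes "finite I" and N: "\<And>i. prob_space (N i)"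
    and "f \<in> borel_measurable (PiM I N)" "g \<in> borel_measurable (PiM I N)"
    and "\<And>x. x \<in> space (PiM I N) \<Longrightarrow> \<bar>f x\<bar> \<le> B" "\<And>x. x \<in> space (PiM I N) \<Longrightarrow> \<bar>g x\<bar> \<le> C"
    and "monotone_on (space (PiM I N)) (\<lambda>x y. \<forall>i\<in>I. x i \<le> y i) (\<le>) f"
      "monotone_on (space (PiM I N)) (\<lambda>x y. \<forall>i\<in>I. x i \<le> y i) (\<le>) g"
  shows "(\<integral>x. f x \<partial>PiM I N) * (\<integral>x. g x \<partial>PiM I N) \<le> (\<integral>x. f x * g x \<partial>PiM I N)"
  using \<open>finite I\<close> assms(3-)
proof (induction I arbitrary: f g rule: finite_induct)
  case empty
  then show ?case
    by (simp add: PiM_empty lebesgue_integral_count_space_finite)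
next
  case (insert i I)
  interpret Ni: prob_space "N i"
    by (rule N)
  interpret J: prob_space "PiM (insert i I) N"
    by (rule prob_space_PiM) (rule N)
  interpret product_prob_space N "insert i I"
    by (rule product_prob_spaceI) (rule N)
  interpret I: prob_space "PiM I N"
    by (rule prob_space_PiM) (rule N)
  note [measurable] = insert.prems(1,2)
  have upd: "x(i := y) \<in> space (PiM (insert i I) N)" if "x \<in> space (PiM I N)" "y \<in> space (N i)"
    for x y
    using that by (auto simp: space_PiM PiE_iff extensional_def)
  have [measurable]: "(\<lambda>y. x(i := y)) \<in> measurable (N i) (PiM (insert i I) N)"
    if "x \<in> space (PiM I N)" for x
    using that by measurable
  have f_int: "integrable (N i) (\<lambda>y. f (x(i := y)))"
    and g_int: "integrable (N i) (\<lambda>y. g (x(i := y)))" if "x \<in> space (PiM I N)" for x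
    by (rule Ni.integrable_const_bound, use insert.prems upd that in \<open>auto intro!: AE_I2\<close>)+
  define F G where "F = (\<lambda>x. \<integral>y. f (x(i := y)) \<partial>N i)" and "G = (\<lambda>x. \<integral>y. g (x(i := y)) \<partial>N i)"
  have [measurable]: "F \<in> borel_measurable (PiM I N)" "G \<in> borel_measurable (PiM I N)"
    unfolding F_def G_def by measurable
  have F_bd: "\<bar>F x\<bar> \<le> B" and G_bd: "\<bar>G x\<bar> \<le> C" if "x \<in> space (PiM I N)" for x
    unfolding F_def G_def using insert.prems(3,4) upd that f_int g_int
    by (auto intro!: Ni.integral_le_const Ni.integral_ge_const AE_I2 simp: abs_le_iff minus_le_iff)
  have F_mono: "monotone_on (space (PiM I N)) (\<lambda>x y. \<forall>i\<in>I. x i \<le> y i) (\<le>) F"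
    unfolding F_def monotone_on_def
    by (safe intro!: integral_mono f_int monotone_onD[OF insert.prems(5)])
      (auto simp: upd upd[unfolded fun_upd_def])
  have G_mono: "monotone_on (space (PiM I N)) (\<lambda>x y. \<forall>i\<in>I. x i \<le> y i) (\<le>) G"
    unfolding G_def monotone_on_def
    by (safe intro!: integral_mono g_int monotone_onD[OF insert.prems(6)])
      (auto simp: upd upd[unfolded fun_upd_def])
  have fg_bd: "\<bar>f x * g x\<bar> \<le> B * C" if "x \<in> space (PiM (insert i I) N)" for x
    using insert.prems(3,4) that by (auto simp: abs_mult intro!: mult_mono')
  have FG_bd: "\<bar>F x * G x\<bar> \<le> B * C" if "x \<in> space (PiM I N)" for x
    using F_bd G_bd that by (auto simp: abs_mult intro!: mult_mono')
  have eqs: "(\<integral>x. f x \<partial>PiM (insert i I) N) = (\<integral>x. F x \<partial>PiM I N)"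
    "(\<integral>x. g x \<partial>PiM (insert i I) N) = (\<integral>x. G x \<partial>PiM I N)"
    "(\<integral>x. f x * g x \<partial>PiM (insert i I) N) =
      (\<integral>x. (\<integral>y. f (x(i := y)) * g (x(i := y)) \<partial>N i) \<partial>PiM I N)"
    unfolding F_def G_def using insert.hyps insert.prems(3,4) fg_bd
    by (auto intro!: product_integral_insert J.integrable_const_bound AE_I2)
  have "(\<integral>x. F x \<partial>PiM I N) * (\<integral>x. G x \<partial>PiM I N) \<le> (\<integral>x. F x * G x \<partial>PiM I N)"
    by (rule insert.IH) (use F_bd G_bd F_mono G_mono in auto)
  also have "\<dots> \<le> (\<integral>x. (\<integral>y. f (x(i := y)) * g (x(i := y)) \<partial>N i) \<partial>PiM I N)"
  proof (rule integral_mono)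
    show "integrable (PiM I N) (\<lambda>x. F x * G x)"
      using FG_bd by (auto intro!: I.integrable_const_bound AE_I2)
    have fg_int: "integrable (N i) (\<lambda>y. f (x(i := y)) * g (x(i := y)))"
      if "x \<in> space (PiM I N)" for x
     by (rule Ni.integrable_const_bound) (use fg_bd upd that in \<open>auto intro!: AE_I2\<close>)
    have fg_bd2: "\<bar>\<integral>y. f (x(i := y)) * g (x(i := y)) \<partial>N i\<bar> \<le> B * C"
      if "x \<in> space (PiM I N)" for x
      using fg_bd[OF upd] that fg_int
      by (auto intro!: Ni.integral_le_const Ni.integral_ge_const AE_I2
          simp: abs_le_iff minus_le_iff)
    then show "integrable (PiM I N) (\<lambda>x. \<integral>y. f (x(i := y)) * g (x(i := y)) \<partial>N i)"
      by (intro I.integrable_const_bound[where B = "B * C"]) (auto intro!: AE_I2)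
    fix x assume x: "x \<in> space (PiM I N)"
    show "F x * G x \<le> (\<integral>y. f (x(i := y)) * g (x(i := y)) \<partial>N i)"
      unfolding F_def G_def
    proof (rule chebyshev_association[OF N])
      show "\<bar>f (x(i := y))\<bar> \<le> B" "\<bar>g (x(i := y))\<bar> \<le> C" if "y \<in> space (N i)" for y
        using insert.prems(3,4) x that upd by auto
      show "monotone_on (space (N i)) (\<le>) (\<le>) (\<lambda>y. f (x(i := y)))"
        by (rule monotone_onI, rule monotone_onD[OF insert.prems(5)])
          (use x in \<open>auto simp: upd upd[unfolded fun_upd_def]\<close>)
      show "monotone_on (space (N i)) (\<le>) (\<le>) (\<lambda>y. g (x(i := y)))"
        by (rule monotone_onI, rule monotone_onD[OF insert.prems(6)])
          (use x in \<open>auto simp: upd upd[unfolded fun_upd_def]\<close>)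
    qed (use x in measurable)
  qed
  finally show ?case
    by (simp add: eqs)
qed

section \<open>Bernstein approximation of paths\<close>

text \<open>The limit lies in an open set \<open>U\<close> iff, for some m, the sequence eventually
  avoids the open neighbourhood \<open>V m\<close> of radius 1/(m+1) around the complement of
  \<open>U\<close>. This expresses the preimage of \<open>U\<close> through countably many
  measurable sets.\<close>

lemma (in Metric_space) measurable_limitin:
  assumes X: "\<And>n. X n \<in> measurable N (sigma M {U. openin mtopology U})"
    and lim: "\<And>\<omega>. \<omega> \<in> space N \<Longrightarrow> limitin mtopology (\<lambda>n::nat. X n \<omega>) (Y \<omega>) sequentially"
  shows "Y \<in> measurable N (sigma M {U. openin mtopology U})"
proof (rule measurable_measure_of)
  show sub: "{U. openin mtopology U} \<subseteq> Pow M"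
    using openin_subset by fastforce
  show "Y \<in> space N \<rightarrow> M"
    using lim by (auto simp: limitin_metric)
  fix U assume "U \<in> {U. openin mtopology U}"
  then have U: "openin mtopology U" by simp
  define V where "V m = (\<Union>y\<in>M - U. mball y (1 / Suc m))" for m :: nat
  have V: "openin mtopology (V m)" for m
    by (auto simp: V_def)
  have XM: "X n \<omega> \<in> M" if "\<omega> \<in> space N" for n \<omega>
    using measurable_space[OF X that] sub by (simp add: space_measure_of)
  have iff: "Y \<omega> \<in> U \<longleftrightarrow> (\<exists>m n0. \<forall>n\<ge>n0. X n \<omega> \<notin> V m)" if \<omega>: "\<omega> \<in> space N" for \<omega>
  proof
    assume YU: "Y \<omega> \<in> U"
    then obtain e where e: "e > 0" "mball (Y \<omega>) e \<subseteq> U"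
      using U by (auto simp: openin_mtopology)
    \<comment> \<open>Half of \<open>e\<close> pays for the distance from \<open>X n\<close> to the
      limit and half for the distance from \<open>X n\<close> to a point outside \<open>U\<close>;
      together they would put that point into the ball contained in \<open>U\<close>.\<close>
    obtain m where m: "1 / Suc m < e / 2"
      using e nat_approx_posE[of "e / 2"] by (auto simp: inverse_eq_divide)
    obtain n0 where n0: "\<And>n. n \<ge> n0 \<Longrightarrow> d (X n \<omega>) (Y \<omega>) < e / 2"
      using lim[OF \<omega>] e unfolding limitin_metric eventually_sequentially
      by (meson half_gt_zero)
    have "X n \<omega> \<notin> V m" if "n \<ge> n0" for n
    proof
      assume "X n \<omega> \<in> V m"
      then obtain y where y: "y \<in> M" "y \<notin> U" "d y (X n \<omega>) < 1 / Suc m"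
        by (auto simp: V_def)
      have "d (Y \<omega>) y \<le> d (X n \<omega>) (Y \<omega>) + d y (X n \<omega>)"
        using y \<omega> XM lim[OF \<omega>] triangle[of "Y \<omega>" "X n \<omega>" y]
        by (auto simp: limitin_metric commute)
      also have "\<dots> < e"
        using n0[OF that] m y by linarith
      finally show False
        using e y lim[OF \<omega>] by (auto simp: limitin_metric)
    qed
    then show "\<exists>m n0. \<forall>n\<ge>n0. X n \<omega> \<notin> V m" by blast
  next
    assume "\<exists>m n0. \<forall>n\<ge>n0. X n \<omega> \<notin> V m"
    then obtain m n0 where n0: "\<And>n. n \<ge> n0 \<Longrightarrow> X n \<omega> \<notin> V m" by blast
    obtain n1 where n1: "\<And>n. n \<ge> n1 \<Longrightarrow> d (X n \<omega>) (Y \<omega>) < 1 / Suc m"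
      using lim[OF \<omega>] unfolding limitin_metric eventually_sequentially
      by (meson of_nat_0_less_iff zero_less_Suc zero_less_divide_1_iff)
    show "Y \<omega> \<in> U"
    proof (rule ccontr)
      assume "Y \<omega> \<notin> U"
      \<comment> \<open>A limit outside \<open>U\<close> is itself one of the centres of the balls
        forming \<open>V m\<close>.\<close>
      then have "X (max n0 n1) \<omega> \<in> V m"
        using n1[of "max n0 n1"] lim[OF \<omega>] XM[OF \<omega>]
        by (auto simp: V_def limitin_metric commute intro!: bexI[of _ "Y \<omega>"])
      then show False
        using n0[of "max n0 n1"] by simp
    qed
  qed
  have [measurable]: "X n -` V m \<inter> space N \<in> sets N" for n m
    by (rule measurable_sets[OF X]) (use V sub in \<open>auto simp: sets_measure_of\<close>)
  have "Y -` U \<inter> space N =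
      (\<Union>m n0. \<Inter>n\<in>{n0..}. space N - (X n -` V m \<inter> space N))"
  proof (intro set_eqI)
    show "\<omega> \<in> Y -` U \<inter> space N \<longleftrightarrow>
        \<omega> \<in> (\<Union>m n0. \<Inter>n\<in>{n0..}. space N - (X n -` V m \<inter> space N))" for \<omega>
      by (cases "\<omega> \<in> space N") (auto simp: iff)
  qed
  also have "\<dots> \<in> sets N"
    by (intro sets.countable_UN' sets.countable_INT' countableI_type image_subsetI sets.Diff) simp_all
  finally show "Y -` U \<inter> space N \<in> sets N" .
qed

section \<open>Bernstein polynomials as random paths\<close>

lemma restrict_in_path_space:
  assumes "continuous_on {0..T} f"
  shows "restrict f {0..T} \<in> path_space T"
  using continuous_on_eq[OF assms, of "restrict f {0..T}"] by (simp add: mspace_path_metric)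

text \<open>The coefficients are free instead of being sampled from a path, so that the same
  polynomial accepts grid values of the bridge and combinations of residuals. Whole sequences are
  taken, of which the entries up to \<open>n\<close> count.\<close>

definition bernstein_path :: "real \<Rightarrow> nat \<Rightarrow> (nat \<Rightarrow> real) \<Rightarrow> real \<Rightarrow> real" where
  "bernstein_path T n x = (\<lambda>t\<in>{0..T}. \<Sum>k\<le>n. x k * Bernstein n k (t / T))"

lemma bernstein_path_in_path_space: "T > 0 \<Longrightarrow> bernstein_path T n x \<in> path_space T"
  unfolding bernstein_path_def Bernstein_def
  by (intro restrict_in_path_space continuous_intros) auto

lemma bernstein_path_mono:
  assumes "T > 0" "\<And>k. k \<le> n \<Longrightarrow> x k \<le> y k"
  shows "path_le T (bernstein_path T n x) (bernstein_path T n y)"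
  using assms
  by (auto simp: path_le_def bernstein_path_def intro!: sum_mono mult_right_mono Bernstein_nonneg)

lemma path_mdist_le:
  assumes "0 \<le> T" "\<alpha> \<in> path_space T" "\<beta> \<in> path_space T"
    and "\<And>t. t \<in> {0..T} \<Longrightarrow> \<bar>\<alpha> t - \<beta> t\<bar> \<le> e"
  shows "mdist (path_metric T) \<alpha> \<beta> \<le> e"
  unfolding mdist_path_metric[OF assms(1-3)] using assms(1,4) by (intro cSUP_least) auto

text \<open>The Bernstein basis is a non-negative partition of unity, so each basis function is at
  most 1. The crude sum bound suffices for continuity in the coefficients.\<close>

lemma bernstein_path_mdist_le:
  assumes "T > 0"
  shows "mdist (path_metric T) (bernstein_path T n x) (bernstein_path T n y) \<le> (\<Sum>k\<le>n. \<bar>x k - y k\<bar>)"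
proof (rule path_mdist_le)
  fix t assume t: "t \<in> {0..T}"
  have B: "0 \<le> Bernstein n k (t / T)" for k
    using t assms by (intro Bernstein_nonneg) auto
  have B1: "Bernstein n k (t / T) \<le> 1" if "k \<le> n" for k
    using member_le_sum[of k "{..n}" "\<lambda>k. Bernstein n k (t / T)"] that B by auto
  have "\<bar>bernstein_path T n x t - bernstein_path T n y t\<bar> =
      \<bar>\<Sum>k\<le>n. (x k - y k) * Bernstein n k (t / T)\<bar>"
    using t by (simp add: bernstein_path_def sum_subtractf left_diff_distrib)
  also have "\<dots> \<le> (\<Sum>k\<le>n. \<bar>(x k - y k) * Bernstein n k (t / T)\<bar>)"
    by (rule sum_abs)
  also have "\<dots> \<le> (\<Sum>k\<le>n. \<bar>x k - y k\<bar>)"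
    using B B1 by (intro sum_mono) (auto simp: abs_mult intro!: mult_left_le)
  finally show "\<bar>bernstein_path T n x t - bernstein_path T n y t\<bar> \<le> (\<Sum>k\<le>n. \<bar>x k - y k\<bar>)" .
qed (use assms bernstein_path_in_path_space in auto)

lemma continuous_map_bernstein_path:
  assumes "T > 0"
  shows "continuous_map euclidean (path_topology T) (bernstein_path T n)"
proof -
  interpret P: Metric_space "path_space T" "mdist (path_metric T)"
    by (rule Metric_space_mspace_mdist)
  show ?thesis
    unfolding mtopology_of_def P.continuous_map_to_metric
  proof (intro ballI allI impI)
    fix x :: "nat \<Rightarrow> real" and e :: real assume "e > 0"
    let ?U = "{y. (\<Sum>k\<le>n. \<bar>x k - y k\<bar>) < e}"
    have "open ?U"
      by (intro open_Collect_less continuous_intros) (auto intro: continuous_on_product_coordinates)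
    moreover have "bernstein_path T n y \<in> P.mball (bernstein_path T n x) e" if "y \<in> ?U" for y
      using that le_less_trans[OF bernstein_path_mdist_le[OF assms]] bernstein_path_in_path_space[OF assms]
      by auto
    ultimately show "\<exists>U. openin euclidean U \<and> x \<in> U \<and>
        (\<forall>y\<in>U. bernstein_path T n y \<in> P.mball (bernstein_path T n x) e)"
      using \<open>e > 0\<close> by (intro exI[of _ ?U]) auto
  qed
qed

text \<open>Continuity gives Borel measurability, and on real sequences the Borel sets are those of
  the product sigma-algebra. Random coefficients can therefore be checked one by one.\<close>

lemma measurable_bernstein_path:
  assumes "T > 0"
  shows "bernstein_path T n \<in> measurable (PiM UNIV (\<lambda>_. borel)) (path_borel T)"
proof -
  have "bernstein_path T n \<in> measurable borel (path_borel T)"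
    unfolding path_borel_def
  proof (rule measurable_measure_of)
    fix U assume "U \<in> {U. openin (path_topology T) U}"
    then show "bernstein_path T n -` U \<inter> space borel \<in> sets borel"
      using openin_continuous_map_preimage[OF continuous_map_bernstein_path[OF assms]]
      by (auto simp: vimage_def)
  qed (use openin_subset bernstein_path_in_path_space[OF assms] in fastforce)+
  then show ?thesis
    using sets_PiM_equal_borel measurable_cong_sets by blast
qed

lemma path_of_in_path_space:
  "continuous_process M T X \<Longrightarrow> \<omega> \<in> space M \<Longrightarrow> path_of T X \<omega> \<in> path_space T"
  by (auto simp: continuous_process_def path_of_def intro!: restrict_in_path_space)

lemma bernstein_path_limitin:
  assumes T: "T > 0" and \<alpha>: "\<alpha> \<in> path_space T"
  shows "limitin (path_topology T) (\<lambda>n. bernstein_path T n (\<lambda>k. \<alpha> (real k / real n * T))) \<alpha> sequentially"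
proof -
  interpret P: Metric_space "path_space T" "mdist (path_metric T)"
    by (rule Metric_space_mspace_mdist)
  show ?thesis
    unfolding mtopology_of_def P.limitin_metric eventually_sequentially
  proof (intro conjI \<alpha> allI impI)
    fix e :: real assume "e > 0"
    have "continuous_on {0..1} (\<lambda>s. \<alpha> (s * T))"
      using \<alpha> T by (auto simp: mspace_path_metric mult_left_le_one_le intro!: continuous_intros
        continuous_on_compose2[of "{0..T}" \<alpha>])
    from Bernstein_Weierstrass[OF this, of "e / 2"] \<open>e > 0\<close>
    obtain N where N: "\<And>n s. n \<ge> N \<Longrightarrow> s \<in> {0..1} \<Longrightarrow>
        \<bar>\<alpha> (s * T) - (\<Sum>k\<le>n. \<alpha> (real k / real n * T) * Bernstein n k s)\<bar> < e / 2"
      by auto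
    \<comment> \<open>A supremum of values below e/2 is only bounded by e/2 weakly; halving
      \<open>e\<close> restores the strict inequality.\<close>
    have "mdist (path_metric T) (bernstein_path T n (\<lambda>k. \<alpha> (real k / real n * T))) \<alpha> \<le> e / 2"
      if "n \<ge> N" for n
    proof (rule path_mdist_le)
      fix t assume "t \<in> {0..T}"
      then show "\<bar>bernstein_path T n (\<lambda>k. \<alpha> (real k / real n * T)) t - \<alpha> t\<bar> \<le> e / 2"
        using N[OF that, of "t / T"] T by (simp add: bernstein_path_def abs_minus_commute)
    qed (use T \<alpha> bernstein_path_in_path_space in auto)
    then show "\<exists>N. \<forall>n\<ge>N. bernstein_path T n (\<lambda>k. \<alpha> (real k / real n * T)) \<in> path_space T \<and>
        mdist (path_metric T) (bernstein_path T n (\<lambda>k. \<alpha> (real k / real n * T))) \<alpha> < e"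
      using \<open>e > 0\<close> T bernstein_path_in_path_space by (intro exI[of _ N]) fastforce
  qed
qed

lemma grid_point_in_interval: "T > 0 \<Longrightarrow> k \<le> n \<Longrightarrow> real k / real n * T \<in> {0..T}"
  by (cases "n = 0") (auto simp: divide_simps)

lemma bernstein_path_cong:
  "(\<And>k. k \<le> n \<Longrightarrow> x k = y k) \<Longrightarrow> bernstein_path T n x = bernstein_path T n y"
  by (simp add: bernstein_path_def)

lemma measurable_bernstein_path_of:
  assumes "T > 0" and X: "continuous_process M T X"
  shows "(\<lambda>\<omega>. bernstein_path T n (\<lambda>k. path_of T X \<omega> (real k / real n * T)))
    \<in> measurable M (path_borel T)"
proof -
  \<comment> \<open>Cutting off after \<open>n\<close> leaves the polynomial unchanged and keeps
    only grid times in [0,T], where \<open>X\<close> is known to be measurable.\<close>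
  define x where "x \<omega> = (\<lambda>k. if k \<le> n then path_of T X \<omega> (real k / real n * T) else 0)" for \<omega>
  have "x \<in> measurable M (PiM UNIV (\<lambda>_. borel))"
  proof (rule measurable_PiM_single')
    show "(\<lambda>\<omega>. x \<omega> k) \<in> borel_measurable M" for k
      using X grid_point_in_interval[OF assms(1), of k n]
      by (cases "k \<le> n") (auto simp: x_def continuous_process_def path_of_def)
  qed auto
  then have "(\<lambda>\<omega>. bernstein_path T n (x \<omega>)) \<in> measurable M (path_borel T)"
    by (rule measurable_compose) (rule measurable_bernstein_path[OF assms(1)])
  also have "(\<lambda>\<omega>. bernstein_path T n (x \<omega>)) =
      (\<lambda>\<omega>. bernstein_path T n (\<lambda>k. path_of T X \<omega> (real k / real n * T)))"
    by (auto simp: x_def intro!: bernstein_path_cong)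
  finally show ?thesis .
qed

text \<open>Only the single variables \<open>X t\<close> are assumed measurable; Borel measurability
  of the whole path comes from its being the limit of its Bernstein polynomials for every
  outcome.\<close>

lemma measurable_path_of:
  assumes "T > 0" and X: "continuous_process M T X"
  shows "path_of T X \<in> measurable M (path_borel T)"
proof -
  interpret P: Metric_space "path_space T" "mdist (path_metric T)"
    by (rule Metric_space_mspace_mdist)
  show ?thesis
    using measurable_bernstein_path_of[OF assms]
      bernstein_path_limitin[OF assms(1) path_of_in_path_space[OF X]]
    unfolding path_borel_def mtopology_of_def by (rule P.measurable_limitin)
qed

lemma topcontinuous_at_limitin:
  assumes "topcontinuous_at X Y f l" "limitin X x l F"
  shows "limitin Y (\<lambda>i. f (x i)) (f l) F"
  unfolding limitin_def
proof (intro conjI allI impI)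
  show "f l \<in> topspace Y"
    using assms(1) by (auto simp: topcontinuous_at_def)
  fix V assume "openin Y V \<and> f l \<in> V"
  then obtain U where "openin X U" "l \<in> U" "\<And>y. y \<in> U \<Longrightarrow> f y \<in> V"
    using assms(1) by (auto simp: topcontinuous_at_def)
  moreover from this have "\<forall>\<^sub>F i in F. x i \<in> U"
    using assms(2) by (simp add: limitin_def)
  ultimately show "\<forall>\<^sub>F i in F. f (x i) \<in> V"
    by (auto elim: eventually_mono)
qed

section \<open>The bridge on a grid\<close>

lemma nn_integral_lborel_shift:
  fixes f :: "real \<Rightarrow> ennreal"
  assumes "f \<in> borel_measurable borel"
  shows "(\<integral>\<^sup>+x. f x \<partial>lborel) = (\<integral>\<^sup>+x. f (x - t) \<partial>lborel)"
  using nn_integral_real_affine[OF assms, of 1 "- t"] by simp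

text \<open>Completing the square. The left side is the joint density of a first summand x and a sum
  s; the right side is the density of the sum times the conditional density of the summand, with
  mean a s/(a+b) and variance a b/(a+b).\<close>

lemma normal_density_mult_factor:
  assumes "a > 0" "b > 0"
  shows "normal_density 0 (sqrt a) x * normal_density 0 (sqrt b) (s - x) =
    normal_density 0 (sqrt (a + b)) s *
    normal_density 0 (sqrt (a * b / (a + b))) (x - a / (a + b) * s)"
proof -
  have nz: "a \<noteq> 0" "b \<noteq> 0" "a + b \<noteq> 0"
    using assms by auto
  have exps: "- x\<^sup>2 / (2 * a) + - (s - x)\<^sup>2 / (2 * b) =
      - s\<^sup>2 / (2 * (a + b)) + - (x - a / (a + b) * s)\<^sup>2 / (2 * (a * b / (a + b)))"
    using nz by (simp add: divide_simps) (simp add: power2_eq_square algebra_simps)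
  have sqrts: "sqrt (2 * pi * a) * sqrt (2 * pi * b) =
      sqrt (2 * pi * (a + b)) * sqrt (2 * pi * (a * b / (a + b)))"
    unfolding real_sqrt_mult[symmetric] using nz by (simp add: field_simps)
  have mult: "1 / c * exp u * (1 / d * exp v) = 1 / (c * d) * exp (u + v)" for c d u v :: real
    by (simp add: exp_add)
  have "1 / sqrt (2 * pi * a) * exp (- x\<^sup>2 / (2 * a)) *
      (1 / sqrt (2 * pi * b) * exp (- (s - x)\<^sup>2 / (2 * b))) =
      1 / sqrt (2 * pi * (a + b)) * exp (- s\<^sup>2 / (2 * (a + b))) *
      (1 / sqrt (2 * pi * (a * b / (a + b))) *
        exp (- (x - a / (a + b) * s)\<^sup>2 / (2 * (a * b / (a + b)))))"
    unfolding mult exps sqrts ..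
  then show ?thesis
    using assms unfolding normal_density_def by simp
qed

text \<open>The factors \<open>p\<close> and \<open>q\<close> may differ from the marginals by
  constants. Taking whole spaces shows that these constants multiply to 1, so no marginal law has to
  be identified.\<close>

lemma (in prob_space) indep_var_if_prob_factor:
  assumes U_rv: "U \<in> measurable M S" and V_rv: "V \<in> measurable M S'"
  and factor: "\<And>A B. A \<in> sets S \<Longrightarrow> B \<in> sets S' \<Longrightarrow>
      prob (U -` A \<inter> V -` B \<inter> space M) = p A * q B"
  shows "indep_var S U S' V"
proof -
  have U: "prob (U -` A \<inter> space M) = p A * q (space S')" if "A \<in> sets S" for A
  proof -
    have "U -` A \<inter> space M = U -` A \<inter> V -` space S' \<inter> space M"
      using measurable_space[OF V_rv] by auto
    with factor[OF that sets.top] show ?thesis by simp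
  qed
  have V: "prob (V -` B \<inter> space M) = p (space S) * q B" if "B \<in> sets S'" for B
  proof -
    have "V -` B \<inter> space M = U -` space S \<inter> V -` B \<inter> space M"
      using measurable_space[OF U_rv] by auto
    with factor[OF sets.top that] show ?thesis by simp
  qed
  have "U -` space S \<inter> space M = space M"
    using measurable_space[OF U_rv] by auto
  with U[of "space S"] have one: "p (space S) * q (space S') = 1"
    by (simp add: prob_space)
  have Int: "Int_stable {X -` A \<inter> space M |A. A \<in> sets N}" for X :: "'a \<Rightarrow> 'd" and N
  proof (safe intro!: Int_stableI)
    fix A B assume "A \<in> sets N" "B \<in> sets N"
    then show "\<exists>C. (X -` A \<inter> space M) \<inter> (X -` B \<inter> space M) = (X -` C \<inter> space M) \<and> C \<in> sets N"
      by (intro exI[of _ "A \<inter> B"]) auto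
  qed
  show ?thesis
    unfolding indep_var_eq
  proof (intro conjI indep_set_sigma_sets Int U_rv V_rv)
    show "indep_set {U -` A \<inter> space M |A. A \<in> sets S} {V -` A \<inter> space M |A. A \<in> sets S'}"
    proof (safe intro!: indep_setI)
      fix A B assume AB: "A \<in> sets S" "B \<in> sets S'"
      have "U -` A \<inter> space M \<inter> (V -` B \<inter> space M) = U -` A \<inter> V -` B \<inter> space M"
        by auto
      then have "prob ((U -` A \<inter> space M) \<inter> (V -` B \<inter> space M)) =
        p A * q B * (p (space S) * q (space S'))"
        using factor[OF AB] one by simp
      then show "prob ((U -` A \<inter> space M) \<inter> (V -` B \<inter> space M)) =
        prob (U -` A \<inter> space M) * prob (V -` B \<inter> space M)"
        using U[OF AB(1)] V[OF AB(2)] by simp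
    qed (use U_rv V_rv in \<open>auto intro: measurable_sets\<close>)
  qed
qed

text \<open>The planar change of variables to residual and sum is split by Fubini into two
  translations of the line, after which the density factorises.\<close>

lemma (in prob_space) indep_var_normal_regression:
  assumes ab: "a > 0" "b > 0"
    and X: "distributed M lborel X (normal_density 0 (sqrt a))"
    and Y: "distributed M lborel Y (normal_density 0 (sqrt b))"
    and ind: "indep_var borel X borel Y"
  shows "indep_var borel (\<lambda>\<omega>. X \<omega> - a / (a + b) * (X \<omega> + Y \<omega>)) borel (\<lambda>\<omega>. X \<omega> + Y \<omega>)"
proof -
  have [measurable]: "random_variable borel X" "random_variable borel Y"
    using ind by (auto simp: indep_var_eq)
  let ?\<phi> = "\<lambda>v. normal_density 0 (sqrt v)"
  define p q where "p = (\<lambda>A. \<integral>\<^sup>+z. ennreal (?\<phi> (a * b / (a + b)) z) * indicator A z \<partial>lborel)"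
    and "q = (\<lambda>B. \<integral>\<^sup>+s. ennreal (?\<phi> (a + b) s) * indicator B s \<partial>lborel)"
  have "indep_var lborel X lborel Y"
    using ind unfolding indep_var_eq by simp
  then have joint: "distributed M (lborel \<Otimes>\<^sub>M lborel) (\<lambda>\<omega>. (X \<omega>, Y \<omega>)) (\<lambda>(x, y). ?\<phi> a x * ?\<phi> b y)"
    using distributed_joint_indep[OF sigma_finite_lborel sigma_finite_lborel X Y]
    by (simp add: ennreal_mult' case_prod_beta')
  show ?thesis
  proof (rule indep_var_if_prob_factor)
    fix A B :: "real set" assume [measurable]: "A \<in> sets borel" "B \<in> sets borel"
    let ?f = "\<lambda>x y. indicator A (x - a / (a + b) * (x + y)) * indicator B (x + y) :: ennreal"
    let ?E = "(\<lambda>\<omega>. X \<omega> - a / (a + b) * (X \<omega> + Y \<omega>)) -` A \<inter> (\<lambda>\<omega>. X \<omega> + Y \<omega>) -` B \<inter> space M"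
    have [measurable]: "?E \<in> sets M"
      by measurable
    have "emeasure M ?E = (\<integral>\<^sup>+\<omega>. indicator ?E \<omega> \<partial>M)"
      by (rule nn_integral_indicator[symmetric]) measurable
    also have "\<dots> = (\<integral>\<^sup>+\<omega>. ?f (X \<omega>) (Y \<omega>) \<partial>M)"
      by (intro nn_integral_cong) (auto split: split_indicator)
    also have "\<dots> = (\<integral>\<^sup>+z. ennreal (case z of (x, y) \<Rightarrow> ?\<phi> a x * ?\<phi> b y) * (case z of (x, y) \<Rightarrow> ?f x y) \<partial>(lborel \<Otimes>\<^sub>M lborel))"
      using distributed_nn_integral[OF joint, of "\<lambda>(x, y). ?f x y"] by simp
    also have "\<dots> = (\<integral>\<^sup>+x. \<integral>\<^sup>+y. ennreal (?\<phi> a x * ?\<phi> b y) * ?f x y \<partial>lborel \<partial>lborel)"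
      by (subst lborel_pair.Fubini' lborel.nn_integral_fst[symmetric]) auto
    \<comment> \<open>Substitute y = s - x at fixed x. Swapping the integrals then allows the
      substitution z = x - a s/(a+b) at fixed s.\<close>
    also have "\<dots> = (\<integral>\<^sup>+x. \<integral>\<^sup>+s. ennreal (?\<phi> a x * ?\<phi> b (s - x)) * ?f x (s - x) \<partial>lborel \<partial>lborel)"
      by (rule nn_integral_cong, rule nn_integral_lborel_shift) measurable
    also have "\<dots> = (\<integral>\<^sup>+s. \<integral>\<^sup>+x. ennreal (?\<phi> a x * ?\<phi> b (s - x)) * ?f x (s - x) \<partial>lborel \<partial>lborel)"
      by (rule lborel_pair.Fubini') measurable
    also have "\<dots> = (\<integral>\<^sup>+s. \<integral>\<^sup>+z. (ennreal (?\<phi> (a + b) s) * indicator B s) *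
        (ennreal (?\<phi> (a * b / (a + b)) z) * indicator A z) \<partial>lborel \<partial>lborel)"
    proof (rule nn_integral_cong)
      fix s
      have "(\<integral>\<^sup>+z. (ennreal (?\<phi> (a + b) s) * indicator B s) *
          (ennreal (?\<phi> (a * b / (a + b)) z) * indicator A z) \<partial>lborel) =
        (\<integral>\<^sup>+x. (ennreal (?\<phi> (a + b) s) * indicator B s) *
          (ennreal (?\<phi> (a * b / (a + b)) (x - a / (a + b) * s)) *
            indicator A (x - a / (a + b) * s)) \<partial>lborel)"
        by (rule nn_integral_lborel_shift) measurable
      then show "(\<integral>\<^sup>+x. ennreal (?\<phi> a x * ?\<phi> b (s - x)) * ?f x (s - x) \<partial>lborel) =
          (\<integral>\<^sup>+z. (ennreal (?\<phi> (a + b) s) * indicator B s) *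
            (ennreal (?\<phi> (a * b / (a + b)) z) * indicator A z) \<partial>lborel)"
        unfolding normal_density_mult_factor[OF ab] by (simp add: ennreal_mult' mult_ac)
    qed
    also have "\<dots> = q B * p A"
      unfolding p_def q_def by (simp add: nn_integral_cmult nn_integral_multc)
    finally show "prob ?E = enn2real (p A) * enn2real (q B)"
      by (simp add: measure_def enn2real_mult mult.commute)
  qed measurable
qed

text \<open>The new pair is a function of the block {i, j}, which is independent of the block of the
  other indices. Within the pair the factorisation is \<open>uv\<close>; within the other block it
  is inherited from \<open>Y\<close>.\<close>

lemma (in prob_space) indep_vars_replace_pair:
  assumes Y: "indep_vars (\<lambda>_. N) Y I" and "finite I" and ij: "i \<in> I" "j \<in> I" "i \<noteq> j"
    and [measurable]: "u \<in> measurable (N \<Otimes>\<^sub>M N) N" "v \<in> measurable (N \<Otimes>\<^sub>M N) N"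
    and uv: "indep_var N (\<lambda>\<omega>. u (Y i \<omega>, Y j \<omega>)) N (\<lambda>\<omega>. v (Y i \<omega>, Y j \<omega>))"
  shows "indep_vars (\<lambda>_. N) (Y(i := \<lambda>\<omega>. u (Y i \<omega>, Y j \<omega>), j := \<lambda>\<omega>. v (Y i \<omega>, Y j \<omega>))) I"
    (is "indep_vars _ ?Z I")
proof -
  define J where "J = I - {i, j}"
  have I: "I = insert i (insert j J)" "i \<notin> J" "j \<notin> J" "finite J"
    using ij \<open>finite I\<close> by (auto simp: J_def)
  have Y_rv[measurable]: "Y l \<in> measurable M N" if "l \<in> I" for l
    using Y that by (auto simp: indep_vars_def)
  have [measurable]: "Y i \<in> measurable M N" "Y j \<in> measurable M N"
    using ij Y_rv by auto
  \<comment> \<open>For finite \<open>I\<close> the product formula over all indices is enough: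
    subfamilies arise by choosing the whole space at the other indices.\<close>
  have "indep_vars (\<lambda>_. N) ?Z I \<longleftrightarrow>
      (\<forall>A\<in>(\<Pi> l\<in>I. sets N). prob (\<Inter>l\<in>I. ?Z l -` A l \<inter> space M) =
        (\<Prod>l\<in>I. prob (?Z l -` A l \<inter> space M)))"
  proof (rule indep_vars_finite)
    show "random_variable N (?Z l)" if "l \<in> I" for l
      using that by auto
  qed (use ij \<open>finite I\<close> in \<open>auto simp: sets.sigma_sets_eq sets.Int_stable sets.space_closed\<close>)
  also have "\<dots>"
  proof
    fix A assume "A \<in> (\<Pi> l\<in>I. sets N)"
    then have A[measurable]: "A l \<in> sets N" if "l \<in> I" for l
      using that by auto
    have [measurable]: "A i \<in> sets N" "A j \<in> sets N"
      using ij A by auto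
    let ?P = "{x \<in> space (PiM {i, j} (\<lambda>_. N)). u (x i, x j) \<in> A i \<and> v (x i, x j) \<in> A j}"
    let ?Q = "Pi\<^sub>E J A"
    have "prob (\<Inter>l\<in>I. ?Z l -` A l \<inter> space M) =
        prob ((\<lambda>\<omega>. (\<lambda>l\<in>{i, j}. Y l \<omega>, \<lambda>l\<in>J. Y l \<omega>)) -` (?P \<times> ?Q) \<inter> space M)"
      using I ij measurable_space[OF Y_rv]
      by (intro arg_cong[where f = prob]) (auto simp: space_PiM PiE_iff simp del: PiE_empty_domain split: if_splits)
    also have "\<dots> = prob ((\<lambda>\<omega>. \<lambda>l\<in>{i, j}. Y l \<omega>) -` ?P \<inter> space M) *
        prob ((\<lambda>\<omega>. \<lambda>l\<in>J. Y l \<omega>) -` ?Q \<inter> space M)"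
    proof (rule indep_varD[OF indep_var_restrict[OF Y]])
      show "?P \<in> sets (PiM {i, j} (\<lambda>_. N))"
        by measurable
      show "?Q \<in> sets (PiM J (\<lambda>_. N))"
        using I by (intro sets_PiM_I_finite) auto
    qed (use I in auto)
    also have "(\<lambda>\<omega>. \<lambda>l\<in>{i, j}. Y l \<omega>) -` ?P \<inter> space M =
        (\<lambda>\<omega>. (u (Y i \<omega>, Y j \<omega>), v (Y i \<omega>, Y j \<omega>))) -` (A i \<times> A j) \<inter> space M"
      using ij measurable_space[OF Y_rv] by (auto simp: space_PiM)
    also have "prob \<dots> = prob (?Z i -` A i \<inter> space M) * prob (?Z j -` A j \<inter> space M)"
      using indep_varD[OF uv, of "A i" "A j"] ij by simp
    also have "prob ((\<lambda>\<omega>. \<lambda>l\<in>J. Y l \<omega>) -` ?Q \<inter> space M) = (\<Prod>l\<in>J. prob (Y l -` A l \<inter> space M))"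
    \<comment> \<open>\<open>indep_varsD\<close> asks for a nonempty index set; for empty
      \<open>J\<close> both sides equal 1.\<close>
    proof (cases "J = {}")
      case False
      have "(\<lambda>\<omega>. \<lambda>l\<in>J. Y l \<omega>) -` ?Q \<inter> space M = (\<Inter>l\<in>J. Y l -` A l \<inter> space M)"
        using False by (auto simp: PiE_iff)
      also have "prob \<dots> = (\<Prod>l\<in>J. prob (Y l -` A l \<inter> space M))"
        by (rule indep_varsD[OF Y False]) (use I in auto)
      finally show ?thesis .
    qed (simp add: prob_space restrict_def vimage_def)
    also have "\<dots> = (\<Prod>l\<in>J. prob (?Z l -` A l \<inter> space M))"
      using I by (intro prod.cong) auto
    also have "prob (?Z i -` A i \<inter> space M) * prob (?Z j -` A j \<inter> space M) * \<dots> =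
        (\<Prod>l\<in>I. prob (?Z l -` A l \<inter> space M))"
      using I(2-) ij(3) by (subst I(1)) (simp add: mult.assoc del: fun_upd_apply)
    finally show "prob (\<Inter>l\<in>I. ?Z l -` A l \<inter> space M) = (\<Prod>l\<in>I. prob (?Z l -` A l \<inter> space M))" .
  qed
  finally show ?thesis .
qed

text \<open>
  The vectors \<open>(U 0, \<dots>, U (k - 1), S (k + 1), D (k + 1), \<dots>, D (N - 1))\<close> all have independent
  entries: passing from \<open>k\<close> to \<open>k + 1\<close> replaces the Gaussian pair \<open>(S (k + 1), D (k + 1))\<close> by the
  residual of \<open>S (k + 1)\<close> on its sum \<open>S (k + 2)\<close> and that sum.
\<close>
lemma brownian_bridge_regression_indep:
  assumes T: "T > 0" and W: "standard_brownian_motion M T W" and N: "N > 0"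
  defines "S \<equiv> \<lambda>k \<omega>. W (real k / real N * T) \<omega> - W 0 \<omega>"
  shows "prob_space.indep_vars M (\<lambda>_. borel)
    (\<lambda>l \<omega>. S (Suc l) \<omega> - real (Suc l) / real (Suc (Suc l)) * S (Suc (Suc l)) \<omega>) {..<N - 1}"
proof -
  interpret prob_space M
    using W by (simp add: standard_brownian_motion_def continuous_process_def)
  define t where "t k = real k / real N * T" for k
  define h where "h = T / N"
  have h: "h > 0" using T N by (simp add: h_def)
  define D where "D l \<omega> = W (t (Suc l)) \<omega> - W (t l) \<omega>" for l \<omega>
  \<comment> \<open>Indices start at 0, so \<open>U l\<close> is the residual belonging to grid time
    l + 1.\<close>
  define U where "U l \<omega> = S (Suc l) \<omega> - real (Suc l) / real (Suc (Suc l)) * S (Suc (Suc l)) \<omega>" for l \<omega>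
  define Y where "Y k l = (if l < k then U l else if l = k then S (Suc k) else D l)" for k l
  have t_less: "t i < t j" if "i < j" for i j
    using that T N by (simp add: t_def divide_strict_right_mono)
  have t_range: "t i \<in> {0..T}" if "i \<le> N" for i
    using that T N by (auto simp: t_def divide_simps)
  have t_diff: "t (Suc l) - t l = h" "t k - t 0 = k * h" for l k
    by (auto simp: t_def h_def diff_divide_distrib[symmetric] left_diff_distrib[symmetric] add_divide_distrib algebra_simps)
  have S_Suc: "S (Suc k) \<omega> = S k \<omega> + D k \<omega>" for k \<omega>
    by (simp add: S_def D_def t_def)
  have normal: "distributed M lborel (\<lambda>\<omega>. W (t j) \<omega> - W (t i) \<omega>) (normal_density 0 (sqrt (t j - t i)))"
    if "i < j" "j \<le> N" for i j
    using W that t_less[OF that(1)] t_range[of i] t_range[of j]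
    by (auto simp: standard_brownian_motion_def)
  have "indep_vars (\<lambda>_. borel) (Y k) {..<N}" if "k < N" for k
    using that
  proof (induction k)
    case 0
    have "indep_vars (\<lambda>_. borel) D {..<N}"
      unfolding D_def using W t_range t_less by (simp add: standard_brownian_motion_def)
    \<comment> \<open>Subtracting \<open>W 0\<close> in \<open>S\<close> makes this hold for every
      outcome, although \<open>W 0\<close> vanishes only almost surely.\<close>
    moreover have "Y 0 = D"
      by (auto simp: Y_def S_def D_def t_def fun_eq_iff)
    ultimately show ?case by simp
  next
    case (Suc k)
    define c where "c = real (Suc k) / real (Suc (Suc k))"
    \<comment> \<open>The form a/(a+b) of the regression lemma, with the variances a = (k+1) h of
      \<open>S (Suc k)\<close> and b = h of \<open>D (Suc k)\<close>.\<close>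
    have c: "c = (real (Suc k) * h) / (real (Suc k) * h + h)"
    proof -
      have "real (Suc k) * h + h = real (Suc (Suc k)) * h"
        by (simp add: algebra_simps)
      then show ?thesis
        using h by (simp add: c_def del: of_nat_Suc)
    qed
    have YS: "Y k k = S (Suc k)" and YD: "Y k (Suc k) = D (Suc k)"
      by (auto simp: Y_def)
    have ind: "indep_vars (\<lambda>_. borel) (Y k) {..<N}"
      using Suc by simp
    have "indep_var borel (Y k k) borel (\<lambda>\<omega>. \<Sum>l\<in>{Suc k}. Y k l \<omega>)"
      by (rule indep_vars_sum, simp_all, rule indep_vars_subset[OF ind]) (use Suc.prems in auto)
    then have "indep_var borel (S (Suc k)) borel (D (Suc k))"
      by (simp add: YS YD)
    moreover have "distributed M lborel (S (Suc k)) (normal_density 0 (sqrt (real (Suc k) * h)))"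
      using normal[of 0 "Suc k"] Suc.prems unfolding t_diff by (simp add: S_def[abs_def] t_def)
    moreover have "distributed M lborel (D (Suc k)) (normal_density 0 (sqrt h))"
      using normal[of "Suc k" "Suc (Suc k)"] Suc.prems unfolding t_diff by (simp add: D_def[abs_def])
    ultimately have uv: "indep_var borel (\<lambda>\<omega>. S (Suc k) \<omega> - c * (S (Suc k) \<omega> + D (Suc k) \<omega>))
        borel (\<lambda>\<omega>. S (Suc k) \<omega> + D (Suc k) \<omega>)"
      unfolding c using h by (intro indep_var_normal_regression) auto
    have "indep_vars (\<lambda>_. borel) ((Y k)(k := \<lambda>\<omega>. (\<lambda>(x, y). x - c * (x + y)) (Y k k \<omega>, Y k (Suc k) \<omega>),
        Suc k := \<lambda>\<omega>. (\<lambda>(x, y). x + y) (Y k k \<omega>, Y k (Suc k) \<omega>))) {..<N}"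
      by (rule indep_vars_replace_pair[OF ind]) (use Suc.prems uv in \<open>auto simp: YS YD\<close>)
    also have "(Y k)(k := \<lambda>\<omega>. (\<lambda>(x, y). x - c * (x + y)) (Y k k \<omega>, Y k (Suc k) \<omega>),
        Suc k := \<lambda>\<omega>. (\<lambda>(x, y). x + y) (Y k k \<omega>, Y k (Suc k) \<omega>)) = Y (Suc k)"
      unfolding YS YD by (auto simp: fun_eq_iff Y_def U_def S_Suc[of "Suc k"] c_def)
    finally show ?case .
  qed
  \<comment> \<open>At the last stage the entry N - 1 is the terminal value \<open>S N\<close>;
    dropping it leaves exactly the residuals.\<close>
  from this[of "N - 1"] N have "indep_vars (\<lambda>_. borel) (Y (N - 1)) {..<N - 1}"
    by (auto intro: indep_vars_subset)
  also have "?this \<longleftrightarrow> indep_vars (\<lambda>_. borel) U {..<N - 1}"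
    by (rule indep_vars_cong) (auto simp: Y_def)
  finally show ?thesis
    by (simp add: U_def[abs_def])
qed

section \<open>Association for Bernstein polynomials of the bridge\<close>

lemma brownian_bridge_grid_eq:
  assumes T: "T > 0" and N: "N > 0" and W0: "W 0 \<omega> = 0" and k: "k \<le> N"
  defines "S \<equiv> \<lambda>k \<omega>. W (real k / real N * T) \<omega> - W 0 \<omega>"
  shows "brownian_bridge T W (real k / real N * T) \<omega> =
    real k * (\<Sum>l\<in>{k - 1..<N - 1}.
      (S (Suc l) \<omega> - real (Suc l) / real (Suc (Suc l)) * S (Suc (Suc l)) \<omega>) / real (Suc l))"
proof (cases k)
  \<comment> \<open>Here \<open>k - 1\<close> is truncated to 0, but the factor
    \<open>real k\<close> annihilates the sum.\<close>
  case 0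
  then show ?thesis using W0 by (simp add: brownian_bridge_def)
next
  case (Suc m)
  define g where "g l = S (Suc l) \<omega> / real (Suc l)" for l
  have "(\<Sum>l\<in>{k - 1..<N - 1}.
      (S (Suc l) \<omega> - real (Suc l) / real (Suc (Suc l)) * S (Suc (Suc l)) \<omega>) / real (Suc l)) =
      (\<Sum>l\<in>{m..<N - 1}. - (g (Suc l) - g l))"
    using Suc by (intro sum.cong) (auto simp: g_def diff_divide_distrib)
  also have "\<dots> = g m - g (N - 1)"
    unfolding sum_negf using Suc k by (subst sum_Suc_diff') auto
  also have "real k * \<dots> = S k \<omega> - real k / real N * S N \<omega>"
    using Suc N by (simp add: g_def right_diff_distrib)
  finally show ?thesis
    using T N W0 by (simp add: brownian_bridge_def S_def)
qed

lemma continuous_process_brownian_bridge: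
  assumes "T > 0" "continuous_process M T W"
  shows "continuous_process M T (brownian_bridge T W)"
  using assms unfolding continuous_process_def brownian_bridge_def[abs_def]
  by (auto simp del: times_divide_eq_left
      intro!: continuous_intros borel_measurable_diff borel_measurable_times)

text \<open>Almost surely \<open>Z\<close> is a path \<open>H\<close> of the independent residuals
  that is non-decreasing in each of them, so Harris' inequality applies to \<open>F\<close> and
  \<open>G\<close> composed with \<open>H\<close>. The bound \<open>N > 1\<close> makes the index
  set of the residuals nonempty, as the product form of their joint law requires.\<close>

lemma brownian_bridge_bernstein_association:
  fixes F G :: "(real \<Rightarrow> real) \<Rightarrow> real"
  assumes T: "T > 0" and W: "standard_brownian_motion M T W" and N: "N > 1"
    and FG: "F \<in> borel_measurable (path_borel T)" "G \<in> borel_measurable (path_borel T)"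
    and bnd: "\<And>\<alpha>. \<alpha> \<in> path_space T \<Longrightarrow> \<bar>F \<alpha>\<bar> \<le> B" "\<And>\<alpha>. \<alpha> \<in> path_space T \<Longrightarrow> \<bar>G \<alpha>\<bar> \<le> C"
    and mono: "monotone_on (path_space T) (path_le T) (\<le>) F"
      "monotone_on (path_space T) (path_le T) (\<le>) G"
  defines "Z \<equiv> \<lambda>\<omega>. bernstein_path T N
    (\<lambda>k. path_of T (brownian_bridge T W) \<omega> (real k / real N * T))"
  shows "(\<integral>\<omega>. F (Z \<omega>) \<partial>M) * (\<integral>\<omega>. G (Z \<omega>) \<partial>M) \<le> (\<integral>\<omega>. F (Z \<omega>) * G (Z \<omega>) \<partial>M)"
proof -
  have cont: "continuous_process M T W"
    using W by (simp add: standard_brownian_motion_def)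
  then interpret prob_space M
    by (simp add: continuous_process_def)
  define J where "J = {..<N - 1}"
  have J: "finite J" "J \<noteq> {}"
    using N by (auto simp: J_def lessThan_empty_iff)
  define S where "S k \<omega> = W (real k / real N * T) \<omega> - W 0 \<omega>" for k \<omega>
  \<comment> \<open>The default 0 makes every \<open>U l\<close> a random variable, so that
    \<open>\<nu> l\<close> is a probability measure for all l, as Harris' inequality asks.\<close>
  define U where "U l \<omega> = (if l \<in> J then
    S (Suc l) \<omega> - real (Suc l) / real (Suc (Suc l)) * S (Suc (Suc l)) \<omega> else 0)" for l \<omega>
  have "indep_vars (\<lambda>_. borel) U J \<longleftrightarrow> indep_vars (\<lambda>_. borel)
    (\<lambda>l \<omega>. S (Suc l) \<omega> - real (Suc l) / real (Suc (Suc l)) * S (Suc (Suc l)) \<omega>) J"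
    by (rule indep_vars_cong) (auto simp: U_def)
  then have ind: "indep_vars (\<lambda>_. borel) U J"
    using brownian_bridge_regression_indep[OF T W, of N] N by (simp add: S_def J_def)
  have U_rv[measurable]: "random_variable borel (U l)" for l
    using ind by (cases "l \<in> J") (auto simp: indep_vars_def U_def[abs_def])
  define \<nu> where "\<nu> l = distr M borel (U l)" for l
  have [simp]: "sets (PiM J \<nu>) = sets (PiM J (\<lambda>_. borel))"
    by (rule sets_PiM_cong) (auto simp: \<nu>_def)
  have distr: "distr M (PiM J (\<lambda>_. borel)) (\<lambda>\<omega>. \<lambda>l\<in>J. U l \<omega>) = PiM J \<nu>"
    unfolding \<nu>_def using indep_vars_iff_distr_eq_PiM[OF J(2) U_rv] ind by simp
  define H where "H v = bernstein_path T N
    (\<lambda>k. real k * (\<Sum>l\<in>{k - 1..<N - 1}. v l / real (Suc l)))" for v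
  have H_mono: "path_le T (H v) (H w)" if "\<forall>l\<in>J. v l \<le> w l" for v w
    unfolding H_def using that T
    by (intro bernstein_path_mono mult_left_mono sum_mono divide_right_mono) (auto simp: J_def)
  have H_path: "H v \<in> path_space T" for v
    using T by (simp add: H_def bernstein_path_in_path_space)
  have H_meas[measurable]: "H \<in> measurable (PiM J (\<lambda>_. borel)) (path_borel T)"
    unfolding H_def
  proof (rule measurable_compose[OF _ measurable_bernstein_path[OF T]], rule measurable_PiM_single')
    fix k
    have "(\<lambda>v. v l) \<in> borel_measurable (PiM J (\<lambda>_. borel))" if "l \<in> {k - 1..<N - 1}" for l
      using that by (intro measurable_component_singleton) (auto simp: J_def)
    then show "(\<lambda>v. real k * (\<Sum>l\<in>{k - 1..<N - 1}. v l / real (Suc l)))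
        \<in> borel_measurable (PiM J (\<lambda>_. borel))"
      by (intro borel_measurable_times borel_measurable_sum borel_measurable_divide) auto
  qed auto
  have [measurable]: "Z \<in> measurable M (path_borel T)"
    unfolding Z_def
    by (rule measurable_bernstein_path_of[OF T continuous_process_brownian_bridge[OF T cont]])
  have "AE \<omega> in M. W 0 \<omega> = 0"
    using W by (simp add: standard_brownian_motion_def)
  then have Z_eq: "AE \<omega> in M. Z \<omega> = H (\<lambda>l\<in>J. U l \<omega>)"
  proof eventually_elim
    case (elim \<omega>)
    show ?case
      unfolding Z_def H_def
    proof (rule bernstein_path_cong)
      fix k assume "k \<le> N"
      then have "path_of T (brownian_bridge T W) \<omega> (real k / real N * T) =
          real k * (\<Sum>l\<in>{k - 1..<N - 1}.
            (S (Suc l) \<omega> - real (Suc l) / real (Suc (Suc l)) * S (Suc (Suc l)) \<omega>) / real (Suc l))"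
        using brownian_bridge_grid_eq[OF T, of N W \<omega> k] N elim grid_point_in_interval[OF T \<open>k \<le> N\<close>]
        unfolding S_def path_of_def by simp
      also have "\<dots> = real k * (\<Sum>l\<in>{k - 1..<N - 1}. (\<lambda>l\<in>J. U l \<omega>) l / real (Suc l))"
        by (intro arg_cong2[where f = "(*)"] refl sum.cong) (auto simp: J_def U_def)
      finally show "path_of T (brownian_bridge T W) \<omega> (real k / real N * T) =
          real k * (\<Sum>l\<in>{k - 1..<N - 1}. (\<lambda>l\<in>J. U l \<omega>) l / real (Suc l))" .
    qed
  qed
  have transfer: "(\<integral>\<omega>. \<phi> (Z \<omega>) \<partial>M) = (\<integral>v. \<phi> (H v) \<partial>PiM J \<nu>)"
    if [measurable]: "\<phi> \<in> borel_measurable (path_borel T)" for \<phi> :: "(real \<Rightarrow> real) \<Rightarrow> real"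
  proof -
    have "(\<integral>\<omega>. \<phi> (Z \<omega>) \<partial>M) = (\<integral>\<omega>. \<phi> (H (\<lambda>l\<in>J. U l \<omega>)) \<partial>M)"
      using Z_eq by (intro integral_cong_AE) auto
    also have "\<dots> = (\<integral>v. \<phi> (H v) \<partial>PiM J \<nu>)"
      unfolding distr[symmetric] by (intro integral_distr[symmetric]) measurable
    finally show ?thesis .
  qed
  have "(\<integral>v. F (H v) \<partial>PiM J \<nu>) * (\<integral>v. G (H v) \<partial>PiM J \<nu>) \<le> (\<integral>v. F (H v) * G (H v) \<partial>PiM J \<nu>)"
  proof (rule harris_inequality)
    show "prob_space (\<nu> l)" for l
      unfolding \<nu>_def by (rule prob_space_distr) measurable
    show "(\<lambda>v. F (H v)) \<in> borel_measurable (PiM J \<nu>)" "(\<lambda>v. G (H v)) \<in> borel_measurable (PiM J \<nu>)"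
      using FG measurable_compose[OF H_meas] by (simp_all cong: measurable_cong_sets)
    show "monotone_on (space (PiM J \<nu>)) (\<lambda>x y. \<forall>i\<in>J. x i \<le> y i) (\<le>) (\<lambda>v. F (H v))"
      "monotone_on (space (PiM J \<nu>)) (\<lambda>x y. \<forall>i\<in>J. x i \<le> y i) (\<le>) (\<lambda>v. G (H v))"
      using mono H_mono H_path by (auto simp: monotone_on_def)
  qed (use J bnd H_path in auto)
  then show ?thesis
    using transfer[OF FG(1)] transfer[OF FG(2)] transfer[OF borel_measurable_times[OF FG]] by simp
qed

section \<open>Passage to the limit\<close>

text \<open>Continuity is replaced by almost sure convergence along the Bernstein paths. This form
  passes to -F and -G at once, which settles the non-increasing case.\<close>

lemma co_monotony_if_approximable:
  fixes F G :: "(real \<Rightarrow> real) \<Rightarrow> real"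
  assumes T: "T > 0" and W: "standard_brownian_motion M T W"
    and FG[measurable]: "F \<in> borel_measurable (path_borel T)" "G \<in> borel_measurable (path_borel T)"
    and bnd: "\<And>\<alpha>. \<alpha> \<in> path_space T \<Longrightarrow> \<bar>F \<alpha>\<bar> \<le> B" "\<And>\<alpha>. \<alpha> \<in> path_space T \<Longrightarrow> \<bar>G \<alpha>\<bar> \<le> C"
    and mono: "monotone_on (path_space T) (path_le T) (\<le>) F"
      "monotone_on (path_space T) (path_le T) (\<le>) G"
  defines "P \<equiv> path_of T (brownian_bridge T W)"
  defines "Z \<equiv> \<lambda>n \<omega>. bernstein_path T n (\<lambda>k. P \<omega> (real k / real n * T))"
  assumes lim: "AE \<omega> in M. (\<lambda>n. F (Z n \<omega>)) \<longlonglongrightarrow> F (P \<omega>)" "AE \<omega> in M. (\<lambda>n. G (Z n \<omega>)) \<longlonglongrightarrow> G (P \<omega>)"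
  shows "(\<integral>\<omega>. F (P \<omega>) \<partial>M) * (\<integral>\<omega>. G (P \<omega>) \<partial>M) \<le> (\<integral>\<omega>. F (P \<omega>) * G (P \<omega>) \<partial>M)"
proof -
  have cont: "continuous_process M T (brownian_bridge T W)"
    using W unfolding standard_brownian_motion_def
    by (blast intro: continuous_process_brownian_bridge[OF T])
  then interpret prob_space M
    by (simp add: continuous_process_def)
  have [measurable]: "P \<in> measurable M (path_borel T)" "Z n \<in> measurable M (path_borel T)" for n
    unfolding P_def Z_def
    using measurable_path_of[OF T cont] measurable_bernstein_path_of[OF T cont] by auto
  have Z_path: "Z n \<omega> \<in> path_space T" for n \<omega>
    using T by (simp add: Z_def bernstein_path_in_path_space)
  have conv: "(\<lambda>n. \<integral>\<omega>. \<phi> (Z n \<omega>) \<partial>M) \<longlonglongrightarrow> (\<integral>\<omega>. \<phi> (P \<omega>) \<partial>M)"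
    if [measurable]: "\<phi> \<in> borel_measurable (path_borel T)"
      and "\<And>\<alpha>. \<alpha> \<in> path_space T \<Longrightarrow> \<bar>\<phi> \<alpha>\<bar> \<le> K" "AE \<omega> in M. (\<lambda>n. \<phi> (Z n \<omega>)) \<longlonglongrightarrow> \<phi> (P \<omega>)"
    for \<phi> :: "(real \<Rightarrow> real) \<Rightarrow> real" and K
    by (rule integral_dominated_convergence[where w = "\<lambda>_. K"]) (use that Z_path in auto)
  have "AE \<omega> in M. (\<lambda>n. F (Z n \<omega>) * G (Z n \<omega>)) \<longlonglongrightarrow> F (P \<omega>) * G (P \<omega>)"
    using lim by eventually_elim (rule tendsto_mult)
  moreover have "\<bar>F \<alpha> * G \<alpha>\<bar> \<le> B * C" if "\<alpha> \<in> path_space T" for \<alpha>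
    using bnd that by (auto simp: abs_mult intro!: mult_mono')
  ultimately have lim_FG: "(\<lambda>n. \<integral>\<omega>. F (Z n \<omega>) * G (Z n \<omega>) \<partial>M)
      \<longlonglongrightarrow> (\<integral>\<omega>. F (P \<omega>) * G (P \<omega>) \<partial>M)"
    using conv[OF borel_measurable_times[OF FG]] by blast
  show ?thesis
  proof (rule LIMSEQ_le[OF tendsto_mult lim_FG])
    show "(\<lambda>n. \<integral>\<omega>. F (Z n \<omega>) \<partial>M) \<longlonglongrightarrow> (\<integral>\<omega>. F (P \<omega>) \<partial>M)"
      by (rule conv[OF FG(1) bnd(1) lim(1)])
    show "(\<lambda>n. \<integral>\<omega>. G (Z n \<omega>) \<partial>M) \<longlonglongrightarrow> (\<integral>\<omega>. G (P \<omega>) \<partial>M)"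
      by (rule conv[OF FG(2) bnd(2) lim(2)])
    show "\<exists>N. \<forall>n\<ge>N. (\<integral>\<omega>. F (Z n \<omega>) \<partial>M) * (\<integral>\<omega>. G (Z n \<omega>) \<partial>M) \<le> (\<integral>\<omega>. F (Z n \<omega>) * G (Z n \<omega>) \<partial>M)"
      using brownian_bridge_bernstein_association[OF T W _ FG bnd mono]
      unfolding Z_def P_def by (intro exI[of _ 2]) auto
  qed
qed

theorem mainTheorem10:
  fixes M :: "'a measure" and T :: real and W :: "real \<Rightarrow> 'a \<Rightarrow> real"
  assumes "T > 0"
    and "standard_brownian_motion M T W"
  shows "functional_co_monotony_principle M T (brownian_bridge T W)"
proof -
  let ?P = "path_of T (brownian_bridge T W)"
  let ?Z = "\<lambda>n \<omega>. bernstein_path T n (\<lambda>k. ?P \<omega> (real k / real n * T))"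
  have cont: "continuous_process M T (brownian_bridge T W)"
    using assms(2) unfolding standard_brownian_motion_def
    by (blast intro: continuous_process_brownian_bridge[OF assms(1)])
  have lim: "AE \<omega> in M. (\<lambda>n. \<phi> (?Z n \<omega>)) \<longlonglongrightarrow> \<phi> (?P \<omega>)"
    if "AE_path_continuous M T (brownian_bridge T W) \<phi>" for \<phi>
  proof -
    \<comment> \<open>The exceptional null set lives on path space; measurability of the path map
      pulls it back to \<open>M\<close>.\<close>
    have "AE \<omega> in M. topcontinuous_at (path_topology T) euclidean \<phi> (?P \<omega>)"
      using that measurable_path_of[OF assms(1) cont] unfolding AE_path_continuous_def
      by (rule AE_distrD[rotated])
    then show ?thesis
    proof (rule AE_mp, intro AE_I2 impI)
      fix \<omega> assume "\<omega> \<in> space M" "topcontinuous_at (path_topology T) euclidean \<phi> (?P \<omega>)"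
      then show "(\<lambda>n. \<phi> (?Z n \<omega>)) \<longlonglongrightarrow> \<phi> (?P \<omega>)"
        using topcontinuous_at_limitin
          bernstein_path_limitin[OF assms(1) path_of_in_path_space[OF cont]] by fastforce
    qed
  qed
  have "(\<integral>\<omega>. F (?P \<omega>) \<partial>M) * (\<integral>\<omega>. G (?P \<omega>) \<partial>M) \<le> (\<integral>\<omega>. F (?P \<omega>) * G (?P \<omega>) \<partial>M)"
    if FG: "F \<in> borel_measurable (path_borel T)" "G \<in> borel_measurable (path_borel T)"
      and bnd: "bounded (F ` path_space T)" "bounded (G ` path_space T)"
      and co: "co_monotone T F G"
      and AE: "AE_path_continuous M T (brownian_bridge T W) F"
        "AE_path_continuous M T (brownian_bridge T W) G"
    for F G
  proof -
    obtain B C where BC: "\<And>\<alpha>. \<alpha> \<in> path_space T \<Longrightarrow> \<bar>F \<alpha>\<bar> \<le> B"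
      "\<And>\<alpha>. \<alpha> \<in> path_space T \<Longrightarrow> \<bar>G \<alpha>\<bar> \<le> C"
      using bnd unfolding bounded_iff by auto
    consider
      (incr) "monotone_on (path_space T) (path_le T) (\<le>) F" "monotone_on (path_space T) (path_le T) (\<le>) G"
      | (decr) "monotone_on (path_space T) (path_le T) (\<ge>) F" "monotone_on (path_space T) (path_le T) (\<ge>) G"
      using co unfolding co_monotone_def by blast
    then show ?thesis
    proof cases
      case incr
      show ?thesis
        by (rule co_monotony_if_approximable[OF assms FG BC incr lim[OF AE(1)] lim[OF AE(2)]])
    next
      case decr
      \<comment> \<open>Changing both signs makes the functionals non-decreasing and alters neither
        side of the inequality.\<close>
      have "AE \<omega> in M. (\<lambda>n. - F (?Z n \<omega>)) \<longlonglongrightarrow> - F (?P \<omega>)"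
        using lim[OF AE(1)] by (rule eventually_mono) (rule tendsto_minus)
      moreover have "AE \<omega> in M. (\<lambda>n. - G (?Z n \<omega>)) \<longlonglongrightarrow> - G (?P \<omega>)"
        using lim[OF AE(2)] by (rule eventually_mono) (rule tendsto_minus)
      ultimately have "(\<integral>\<omega>. - F (?P \<omega>) \<partial>M) * (\<integral>\<omega>. - G (?P \<omega>) \<partial>M) \<le> (\<integral>\<omega>. - F (?P \<omega>) * - G (?P \<omega>) \<partial>M)"
        using decr FG BC
        by (intro co_monotony_if_approximable[OF assms, of "\<lambda>\<alpha>. - F \<alpha>" "\<lambda>\<alpha>. - G \<alpha>" B C])
          (auto simp: monotone_on_def)
      then show ?thesis
        by simp
    qed
  qed
  with cont show ?thesis
    unfolding functional_co_monotony_principle_def by blast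
qed

end
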